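(* Let $\lambda_1=\frac{3x+\sqrt{9x^2-8}}{2}$ and $\lambda_2=\frac{3x-\sqrt{9x^2-8}}{2}$ be the roots of $\lambda^2-3x\lambda+2=0$. For every integer $n\ge 0$, the Mersenne Lucas polynomials and the Gaussian Mersenne Lucas polynomials satisfy respectively $$m_n(x)=\lambda_1^n+\lambda_2^n,$$ $$Gm_n(x)=\lambda_1^n+\lambda_2^n+i\left(\lambda_1^{n-1}+\lambda_2^{n-1}\right).$$
   Context: Here $i$ is the imaginary unit, and $x$ is the polynomial variable (it may be read as an arbitrary complex number, with a fixed choice of square root $\sqrt{9x^2-8}$). The Mersenne Lucas polynomials are defined by $m_0(x)=2$, $m_1(x)=3x$, $m_n(x)=3x\,m_{n-1}(x)-2m_{n-2}(x)$ for $n\ge2$. The Gaussian Mersenne Lucas polynomials are defined by $Gm_0(x)=2+\frac{3i}{2}x$, $Gm_1(x)=3x+2i$, $Gm_n(x)=3x\,Gm_{n-1}(x)-2Gm_{n-2}(x)$ for $n\ge2$. *)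

theory Defs
  imports Complex_Main "HOL-Computational_Algebra.Polynomial"
begin

fun mersenne_lucas :: "nat \<Rightarrow> complex poly" where
  "mersenne_lucas 0 = [:2:]"
| "mersenne_lucas (Suc 0) = [:0, 3:]"
| "mersenne_lucas (Suc (Suc n)) =
     [:0, 3:] * mersenne_lucas (Suc n) - [:2:] * mersenne_lucas n"

fun gauss_mersenne_lucas :: "nat \<Rightarrow> complex poly" where
  "gauss_mersenne_lucas 0 = [:2, 3 * \<i> / 2:]"
| "gauss_mersenne_lucas (Suc 0) = [:2 * \<i>, 3:]"
| "gauss_mersenne_lucas (Suc (Suc n)) =
     [:0, 3:] * gauss_mersenne_lucas (Suc n) - [:2:] * gauss_mersenne_lucas n"

end

theory Submission
  imports Defs
begin

text \<open>
  By Vieta, the roots of \<open>z\<^sup>2 - 3xz + 2\<close> satisfy \<open>\<lambda>\<^sub>1 + \<lambda>\<^sub>2 = 3x\<close> and \<open>\<lambda>\<^sub>1\<lambda>\<^sub>2 = 2\<close>. Their power sums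
  therefore obey the recurrence of the Mersenne Lucas polynomials, with the same initial values
  \<open>2\<close> and \<open>3x\<close>. The formula is not affected by a double root, since a sum of powers, unlike a
  Binet quotient, has no denominator \<open>\<lambda>\<^sub>1 - \<lambda>\<^sub>2\<close>.

  The Gaussian polynomials satisfy the same linear recurrence and start as \<open>m\<^sub>n + \<i> m\<^sub>n\<^sub>-\<^sub>1\<close>, so they
  keep this form for all \<open>n \<ge> 1\<close>. The index \<open>n = 0\<close> extends the pattern backwards:
  the recurrence would force \<open>m\<^sub>-\<^sub>1 = 3x/2\<close>, and this equals
  \<open>1/\<lambda>\<^sub>1 + 1/\<lambda>\<^sub>2 = (\<lambda>\<^sub>1 + \<lambda>\<^sub>2) / (\<lambda>\<^sub>1\<lambda>\<^sub>2)\<close>; both roots are nonzero because their product is \<open>2\<close>.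
\<close>

lemma poly_mersenne_lucas_power_sum:
  assumes "a + b = 3 * x" and "a * b = 2"
  shows "poly (mersenne_lucas n) x = a ^ n + b ^ n"
proof (induction n rule: mersenne_lucas.induct)
  case (3 n)
  have "poly (mersenne_lucas (Suc (Suc n))) x
      = (a + b) * (a ^ Suc n + b ^ Suc n) - (a * b) * (a ^ n + b ^ n)"
    using 3 assms by (simp add: algebra_simps)
  also have "\<dots> = a ^ Suc (Suc n) + b ^ Suc (Suc n)"
    by (simp add: algebra_simps)
  finally show ?case .
qed (use assms in \<open>simp_all add: algebra_simps\<close>)

text \<open>
  Both sides solve the same linear recurrence, so it is enough that they agree at the first two
  indices. Starting at index \<open>1\<close> avoids a Mersenne Lucas polynomial with a negative index.
\<close>
lemma gauss_mersenne_lucas_Suc: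
  "gauss_mersenne_lucas (Suc n) = mersenne_lucas (Suc n) + [:\<i>:] * mersenne_lucas n"
proof (induction n rule: mersenne_lucas.induct)
  case (3 n)
  have "gauss_mersenne_lucas (Suc (Suc (Suc n)))
      = [:0, 3:] * gauss_mersenne_lucas (Suc (Suc n)) - [:2:] * gauss_mersenne_lucas (Suc n)"
    by (rule gauss_mersenne_lucas.simps(3))
  also have "\<dots> = ([:0, 3:] * mersenne_lucas (Suc (Suc n)) - [:2:] * mersenne_lucas (Suc n))
      + [:\<i>:] * ([:0, 3:] * mersenne_lucas (Suc n) - [:2:] * mersenne_lucas n)"
    unfolding 3 by (simp only: algebra_simps)
  finally show ?case
    by (simp only: mersenne_lucas.simps(3))
qed (simp_all add: algebra_simps)

theorem theorem7:
  fixes x s lam1 lam2 :: complex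
  assumes root: "s ^ 2 = 9 * x ^ 2 - 8"
    and lambda1: "lam1 = (3 * x + s) / 2"
    and lambda2: "lam2 = (3 * x - s) / 2"
  shows "{z. z ^ 2 - 3 * x * z + 2 = 0} = {lam1, lam2} \<and>
    (\<forall>n :: nat.
      poly (mersenne_lucas n) x = lam1 ^ n + lam2 ^ n \<and>
      poly (gauss_mersenne_lucas n) x =
        lam1 ^ n + lam2 ^ n
          + \<i> * (lam1 powi (int n - 1) + lam2 powi (int n - 1)))"
proof -
  have sum: "lam1 + lam2 = 3 * x"
    unfolding lambda1 lambda2 by (simp add: field_simps)
  have "lam1 * lam2 = (9 * x ^ 2 - s ^ 2) / 4"
    unfolding lambda1 lambda2 by (simp add: field_simps power2_eq_square)
  then have prod: "lam1 * lam2 = 2"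
    using root by simp
  then have nonzero: "lam1 \<noteq> 0" "lam2 \<noteq> 0"
    by auto
  have factor: "z ^ 2 - 3 * x * z + 2 = (z - lam1) * (z - lam2)" for z
    unfolding sum [symmetric] prod [symmetric] by (simp add: power2_eq_square algebra_simps)
  have roots: "{z. z ^ 2 - 3 * x * z + 2 = 0} = {lam1, lam2}"
    unfolding factor by auto
  have power_sum: "poly (mersenne_lucas n) x = lam1 ^ n + lam2 ^ n" for n
    using sum prod by (rule poly_mersenne_lucas_power_sum)
  have gauss: "poly (gauss_mersenne_lucas n) x =
      lam1 ^ n + lam2 ^ n + \<i> * (lam1 powi (int n - 1) + lam2 powi (int n - 1))" for n
  proof (cases n)
    case 0
    have "inverse lam1 + inverse lam2 = (lam1 + lam2) / (lam1 * lam2)"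
      using nonzero by (simp add: field_simps)
    then have "inverse lam1 + inverse lam2 = 3 * x / 2"
      using sum prod by simp
    with 0 show ?thesis by (simp add: power_int_minus)
  next
    case (Suc k)
    then show ?thesis by (simp add: gauss_mersenne_lucas_Suc power_sum del: mersenne_lucas.simps)
  qed
  from roots power_sum gauss show ?thesis by blast
qed

end
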